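(* Let $\beta>0$ and $p>2$. If $\omega>0$, then the system $$\begin{cases}-u''+\omega u-|u|^{p-2}u=0\quad\text{on }\mathbb{R}\setminus\{0\},\\ u'(0^+)=u'(0^-),\\ u(0^+)-u(0^-)=\beta u'(0^+)\end{cases}$$ admits exactly three positive solutions belonging to $H^1(\mathbb{R}^-)\oplus H^1(\mathbb{R}^+)$. One of them is the soliton $\phi_\omega$ centered at $0$, while the other two have a discontinuity at the origin and are $u_{1,\omega}$, of the form $$u_{1,\omega}(x)=\begin{cases}\phi_\omega(x+x_+),& x>0,\\ \phi_\omega(x+x_-),& x<0,\end{cases}$$ with $x_+>x_->0$, and $u_{2,\omega}(x)=u_{1,\omega}(-x)$. Here $t_\pm:=\tanh\left(\frac{p-2}{2}\sqrt{\omega}\,x_\pm\right)$ solve the system $$\begin{cases}t_+(1-t_+^2)^{\frac{1}{p-2}}=t_-(1-t_-^2)^{\frac{1}{p-2}},\\ t_+^{-1}-t_-^{-1}=-\beta\sqrt{\omega},\end{cases}$$ and it holds that $0<t_-<\sqrt{\frac{p-2}{p}}<t_+<1$.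
   Context: $\mathbb{R}^-=(-\infty,0)$, $\mathbb{R}^+=(0,+\infty)$; the space $H^1(\mathbb{R}^-)\oplus H^1(\mathbb{R}^+)$ consists of functions on $\mathbb{R}\setminus\{0\}$ whose restrictions to the two half-lines are in $H^1$, and $u(0^\pm)$, $u'(0^\pm)$ denote one-sided limits at $0$. Positive means strictly positive on $\mathbb{R}\setminus\{0\}$. The soliton at frequency $\omega>0$ is $$\phi_\omega(x):=\left(\frac{\omega p}{2\cosh^2\left(\frac{p-2}{2}\sqrt{\omega}\,x\right)}\right)^{\frac1{p-2}},\quad x\in\mathbb{R}.$$ *)

theory Defs
  imports "HOL-Analysis.Analysis" "HOL-Library.FuncSet"
begin

definition test_fun_on :: "real set \<Rightarrow> (real \<Rightarrow> real) \<Rightarrow> bool" where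
  "test_fun_on I \<phi> \<longleftrightarrow>
     (\<forall>k x. (deriv ^^ k) \<phi> field_differentiable at x) \<and>
     compact (closure {x. \<phi> x \<noteq> 0}) \<and> closure {x. \<phi> x \<noteq> 0} \<subseteq> I"

definition L2_on :: "real set \<Rightarrow> (real \<Rightarrow> real) \<Rightarrow> bool" where
  "L2_on I u \<longleftrightarrow> set_borel_measurable lebesgue I u \<and> set_integrable lebesgue I (\<lambda>x. (u x)\<^sup>2)"

definition has_weak_deriv_on :: "(real \<Rightarrow> real) \<Rightarrow> (real \<Rightarrow> real) \<Rightarrow> real set \<Rightarrow> bool" where
  "has_weak_deriv_on u v I \<longleftrightarrow>
     (\<forall>\<phi>. test_fun_on I \<phi> \<longrightarrow>
        (LINT x:I|lebesgue. u x * deriv \<phi> x) = - (LINT x:I|lebesgue. v x * \<phi> x))"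

text \<open>The Sobolev space \<open>H\<^sup>1(I)\<close> of an open set \<open>I\<close>, as a set of representatives (no quotient by
  almost everywhere equality); only the values on \<open>I\<close> matter. Both integrals in the defining
  identity of the weak derivative converge, since all factors are square integrable on \<open>I\<close>.\<close>

definition H1_on :: "real set \<Rightarrow> (real \<Rightarrow> real) set" where
  "H1_on I = {u. L2_on I u \<and> (\<exists>v. L2_on I v \<and> has_weak_deriv_on u v I)}"

text \<open>Functions on the punctured line are represented by total functions with the fixed value
  \<open>undefined\<close> at the origin (\<open>extensional\<close>), so that equality of functions is equality off the
  origin and solutions can be counted.\<close>

definition H1_split :: "(real \<Rightarrow> real) set" where
  "H1_split = {u \<in> extensional (- {0}). u \<in> H1_on {..<0} \<and> u \<in> H1_on {0<..}}"

text \<open>The equation is understood pointwise: \<open>u\<close> is twice differentiable away from the origin. The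
  conditions at the origin include the existence of the four one-sided limits.\<close>

definition solves_system :: "real \<Rightarrow> real \<Rightarrow> real \<Rightarrow> (real \<Rightarrow> real) \<Rightarrow> bool" where
  "solves_system \<beta> p \<omega> u \<longleftrightarrow>
     (\<forall>x. x \<noteq> 0 \<longrightarrow>
        u field_differentiable at x \<and> deriv u field_differentiable at x \<and>
        - deriv (deriv u) x + \<omega> * u x - \<bar>u x\<bar> powr (p - 2) * u x = 0) \<and>
     (\<exists>ur ul dr dl.
        (u \<longlongrightarrow> ur) (at_right 0) \<and> (u \<longlongrightarrow> ul) (at_left 0) \<and>
        (deriv u \<longlongrightarrow> dr) (at_right 0) \<and> (deriv u \<longlongrightarrow> dl) (at_left 0) \<and>
        dr = dl \<and> ur - ul = \<beta> * dr)"

definition positive_solutions :: "real \<Rightarrow> real \<Rightarrow> real \<Rightarrow> (real \<Rightarrow> real) set" where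
  "positive_solutions \<beta> p \<omega> =
     {u \<in> H1_split. solves_system \<beta> p \<omega> u \<and> (\<forall>x. x \<noteq> 0 \<longrightarrow> u x > 0)}"

definition soliton :: "real \<Rightarrow> real \<Rightarrow> real \<Rightarrow> real" where
  "soliton p \<omega> x =
     (\<omega> * p / (2 * (cosh ((p - 2) / 2 * sqrt \<omega> * x))\<^sup>2)) powr (1 / (p - 2))"

definition shifted_solitons :: "real \<Rightarrow> real \<Rightarrow> real \<Rightarrow> real \<Rightarrow> real \<Rightarrow> real" where
  "shifted_solitons p \<omega> xp xm =
     (\<lambda>x\<in>- {0}. if x > 0 then soliton p \<omega> (x + xp) else soliton p \<omega> (x + xm))"

text \<open>As a function on the punctured line has no value at the origin, a discontinuity there means
  that it has no continuous extension, i.e. no two-sided limit.\<close>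

definition discontinuous_at_origin :: "(real \<Rightarrow> real) \<Rightarrow> bool" where
  "discontinuous_at_origin u \<longleftrightarrow> \<not> (\<exists>l. (u \<longlongrightarrow> l) (at 0))"

end

theory Submission
  imports Defs "HOL-Probability.Sinc_Integral"
begin

text \<open>On each half-line the equation conserves the energy \<open>u'\<^sup>2 - \<omega> u\<^sup>2 + (2/p) u\<^sup>p\<close>. A positive
square integrable solution takes arbitrarily small values arbitrarily far from the origin, and this
forces the energy to vanish: a negative energy would keep \<open>u\<close> away from zero, and with a positive
energy \<open>u\<close> is steep wherever it is small, so that once small and decreasing it cannot turn around
before it becomes negative. At zero energy the substitution \<open>w = u powr (-(p - 2)/2)\<close> makes the
equation linear, \<open>w'' = \<kappa>\<^sup>2 w\<close> with \<open>\<kappa> = (p - 2)/2 * sqrt \<omega>\<close>, and the energy relation selects the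
multiples of \<open>cosh (\<kappa> (x + a))\<close> that correspond to translates of the soliton
(\<open>halfline_profile.shifted_soliton\<close>). Linearity also settles how \<open>u\<close> continues through a point with
\<open>u' = 0\<close>, where the first-order energy relation does not determine it.\<close>

text \<open>Hence the positive solutions are exactly the pairs of translates, by \<open>a\<close> on the right and by \<open>b\<close> on
the left, that satisfy the two conditions at the origin (\<open>positive_solutions_eq\<close>). Since
\<open>\<phi>' = - sqrt \<omega> tanh (\<kappa> x) \<phi>\<close> and \<open>\<phi>\<close> is a constant times \<open>(1 - tanh\<^sup>2 (\<kappa> x)) powr (1/(p - 2))\<close>, these
are conditions on \<open>tanh (\<kappa> a)\<close> and \<open>tanh (\<kappa> b)\<close>: either both vanish, which is the soliton, or
\<open>g t = t (1 - t\<^sup>2) powr (1/(p - 2))\<close> agrees at the two points and their reciprocals differ by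
\<open>- \<beta> sqrt \<omega>\<close>. As \<open>g\<close> is odd, increasing from \<open>0\<close> to \<open>sqrt ((p - 2)/p)\<close> and decreasing from there to
\<open>1\<close>, the latter system has exactly one positive solution (\<open>jump_pair_exists\<close>, \<open>jump_pair_unique\<close>); the
reflection \<open>(t, s) \<mapsto> (- s, - t)\<close> gives the only other one, and it corresponds to \<open>x \<mapsto> - x\<close>.\<close>


section \<open>The soliton profile\<close>

lemma tanh_square_lt_1: "(tanh x)\<^sup>2 < 1" for x :: real
  using tanh_real_bounds[of x] by (simp add: abs_square_less_1 abs_if)

lemma one_minus_tanh_square: "1 - (tanh x)\<^sup>2 = 1 / (cosh x)\<^sup>2" for x :: real
proof -
  have "1 - (tanh x)\<^sup>2 = ((cosh x)\<^sup>2 - (sinh x)\<^sup>2) / (cosh x)\<^sup>2"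
    by (simp add: tanh_def power_divide diff_divide_distrib)
  then show ?thesis by (simp add: cosh_square_eq)
qed

lemma tanh_artanh:
  fixes t :: real
  assumes "\<bar>t\<bar> < 1"
  shows "tanh (artanh t) = t"
proof -
  have *: "exp (- 2 * artanh t) = (1 - t) / (1 + t)"
    using assms by (simp add: artanh_def exp_minus)
  then show ?thesis
    unfolding tanh_real_altdef * using assms by (simp add: field_simps)
qed

definition soliton_rate :: "real \<Rightarrow> real \<Rightarrow> real" where
  "soliton_rate p \<omega> = (p - 2) / 2 * sqrt \<omega>"

lemma soliton_minus: "soliton p \<omega> (- x) = soliton p \<omega> x"
  by (simp add: soliton_def)

definition soliton_deriv :: "real \<Rightarrow> real \<Rightarrow> real \<Rightarrow> real" where
  "soliton_deriv p \<omega> x = - sqrt \<omega> * tanh (soliton_rate p \<omega> * x) * soliton p \<omega> x"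

context
  fixes p \<omega> :: real
  assumes p_gt_2: "p > 2" and omega_pos: "\<omega> > 0"
begin

lemma soliton_rate_pos: "soliton_rate p \<omega> > 0"
  using p_gt_2 omega_pos by (simp add: soliton_rate_def)

lemma soliton_pos: "soliton p \<omega> x > 0"
  using p_gt_2 omega_pos by (simp add: soliton_def)

lemma soliton_powr_tanh:
  "soliton p \<omega> x powr (p - 2) = \<omega> * p / 2 * (1 - (tanh (soliton_rate p \<omega> * x))\<^sup>2)"
  unfolding soliton_def powr_powr one_minus_tanh_square soliton_rate_def
  using p_gt_2 omega_pos by simp

lemma soliton_tanh:
  "soliton p \<omega> x = (\<omega> * p / 2) powr (1 / (p - 2)) * (1 - (tanh (soliton_rate p \<omega> * x))\<^sup>2) powr (1 / (p - 2))"
  unfolding soliton_def one_minus_tanh_square soliton_rate_def using p_gt_2 omega_pos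
  by (simp flip: powr_mult)

lemma DERIV_soliton:
  "(soliton p \<omega> has_real_derivative soliton_deriv p \<omega> x) (at x)"
proof -
  define K s where "K = (\<omega> * p / 2) powr (1 / (p - 2))" and "s = 1 / (p - 2)"
  have ks: "soliton_rate p \<omega> * s * 2 = sqrt \<omega>" unfolding s_def soliton_rate_def using p_gt_2 by (simp add: field_simps)
  have eq: "soliton p \<omega> = (\<lambda>x. K * (1 - (tanh (soliton_rate p \<omega> * x))\<^sup>2) powr s)"
    by (simp add: fun_eq_iff soliton_tanh K_def s_def)
  define v where "v = 1 - (tanh (soliton_rate p \<omega> * x))\<^sup>2"
  have v: "v > 0" using tanh_square_lt_1 by (simp add: v_def)
  have "((\<lambda>x. 1 - (tanh (soliton_rate p \<omega> * x))\<^sup>2) has_real_derivative - 2 * tanh (soliton_rate p \<omega> * x) * (soliton_rate p \<omega> * v)) (at x)"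
    unfolding v_def by (auto intro!: derivative_eq_intros)
  from has_real_derivative_powr'[OF this DERIV_const[of s]] v
  have "((\<lambda>x. (1 - (tanh (soliton_rate p \<omega> * x))\<^sup>2) powr s) has_real_derivative
      v powr s * (- 2 * tanh (soliton_rate p \<omega> * x) * (soliton_rate p \<omega> * v) * s / v)) (at x)"
    by (simp add: v_def)
  then have "((\<lambda>x. K * (1 - (tanh (soliton_rate p \<omega> * x))\<^sup>2) powr s) has_real_derivative
      K * (v powr s * (- 2 * tanh (soliton_rate p \<omega> * x) * (soliton_rate p \<omega> * v) * s / v))) (at x)"
    by (rule DERIV_cmult)
  also have "K * (v powr s * (- 2 * tanh (soliton_rate p \<omega> * x) * (soliton_rate p \<omega> * v) * s / v))
      = - (soliton_rate p \<omega> * s * 2) * tanh (soliton_rate p \<omega> * x) * (K * v powr s)"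
    using v by (simp only: field_simps) (use v in \<open>simp add: field_simps\<close>)
  finally show ?thesis unfolding ks soliton_deriv_def eq v_def .
qed

lemma DERIV_soliton_deriv:
  "(soliton_deriv p \<omega> has_real_derivative
     \<omega> * soliton p \<omega> x - soliton p \<omega> x powr (p - 2) * soliton p \<omega> x) (at x)"
proof -
  define r t f where "r = sqrt \<omega>" and "t = tanh (soliton_rate p \<omega> * x)" and "f = soliton p \<omega> x"
  have r: "\<omega> = r\<^sup>2" "soliton_rate p \<omega> = (p - 2) / 2 * r"
    using omega_pos by (simp_all add: r_def soliton_rate_def)
  have f: "f powr (p - 2) = r\<^sup>2 * p / 2 * (1 - t\<^sup>2)"
    unfolding f_def t_def r(1)[symmetric] by (rule soliton_powr_tanh)
  have "((\<lambda>x. - sqrt \<omega> * tanh (soliton_rate p \<omega> * x) * soliton p \<omega> x) has_real_derivative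
      - r * ((p - 2) / 2 * r * (1 - t\<^sup>2)) * f - r * t * (- r * t * f)) (at x)"
    unfolding t_def f_def r(2)[symmetric] unfolding r_def
    by (auto intro!: derivative_eq_intros DERIV_soliton simp: soliton_deriv_def algebra_simps power2_eq_square)
  also have "- r * ((p - 2) / 2 * r * (1 - t\<^sup>2)) * f - r * t * (- r * t * f)
      = \<omega> * f - f powr (p - 2) * f"
    unfolding f r(1)
    by (simp add: field_simps power2_eq_square)
  finally show ?thesis
    unfolding f_def using ext[of "soliton_deriv p \<omega>", OF soliton_deriv_def] by simp
qed

lemma continuous_soliton [continuous_intros]:
  assumes "continuous_on A f"
  shows "continuous_on A (\<lambda>x. soliton p \<omega> (f x))"
proof -
  have "continuous_on UNIV (soliton p \<omega>)"
    using DERIV_isCont[OF DERIV_soliton] by (simp add: continuous_on_eq_continuous_at)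
  from continuous_on_compose2[OF this assms] show ?thesis by simp
qed

text \<open>Exponential decay puts the soliton in \<open>L\<^sup>2\<close>, and with it its derivative, which is at most
\<open>sqrt \<omega>\<close> times as large.\<close>

lemma soliton_le_exp:
  "soliton p \<omega> x \<le> (2 * \<omega> * p) powr (1 / (p - 2)) * exp (- sqrt \<omega> * \<bar>x\<bar>)"
proof -
  have "exp \<bar>soliton_rate p \<omega> * x\<bar> \<le> 2 * cosh (soliton_rate p \<omega> * x)"
    by (simp add: cosh_def abs_if)
  then have "(exp \<bar>soliton_rate p \<omega> * x\<bar>)\<^sup>2 \<le> (2 * cosh (soliton_rate p \<omega> * x))\<^sup>2"
    by (intro power_mono) auto
  then have "\<omega> * p / (2 * (cosh (soliton_rate p \<omega> * x))\<^sup>2) \<le> 2 * \<omega> * p / (exp \<bar>soliton_rate p \<omega> * x\<bar>)\<^sup>2"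
    using p_gt_2 omega_pos by (simp add: field_simps)
  then have "soliton p \<omega> x \<le> (2 * \<omega> * p / (exp \<bar>soliton_rate p \<omega> * x\<bar>)\<^sup>2) powr (1 / (p - 2))"
    unfolding soliton_def soliton_rate_def using p_gt_2 omega_pos by (intro powr_mono2) auto
  also have "2 * \<omega> * p / (exp \<bar>soliton_rate p \<omega> * x\<bar>)\<^sup>2 = 2 * \<omega> * p * exp (- 2 * soliton_rate p \<omega> * \<bar>x\<bar>)"
    using soliton_rate_pos by (simp add: exp_minus abs_mult divide_inverse flip: exp_of_nat_mult)
  also have "(2 * \<omega> * p * exp (- 2 * soliton_rate p \<omega> * \<bar>x\<bar>)) powr (1 / (p - 2))
      = (2 * \<omega> * p) powr (1 / (p - 2)) * exp (- 2 * soliton_rate p \<omega> * \<bar>x\<bar>) powr (1 / (p - 2))"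
    using p_gt_2 omega_pos by (simp add: powr_mult)
  also have "exp (- 2 * soliton_rate p \<omega> * \<bar>x\<bar>) powr (1 / (p - 2)) = exp (- sqrt \<omega> * \<bar>x\<bar>)"
    using p_gt_2 by (simp add: powr_def soliton_rate_def)
  finally show ?thesis .
qed

end

section \<open>Shifted solitons belong to the Sobolev space\<close>

text \<open>Off its support a test function vanishes on a neighbourhood, so its derivative vanishes as well.\<close>

lemma test_fun_on_eq_0:
  assumes "test_fun_on I \<phi>" and "x \<notin> closure {x. \<phi> x \<noteq> 0}"
  shows "\<phi> x = 0" and "deriv \<phi> x = 0"
proof -
  let ?N = "- closure {x. \<phi> x \<noteq> 0}"
  have zero: "\<phi> y = 0" if "y \<in> ?N" for y
  proof (rule ccontr)
    assume "\<phi> y \<noteq> 0"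
    then have "y \<in> closure {x. \<phi> x \<noteq> 0}" by (intro subsetD[OF closure_subset]) simp
    then show False using that by simp
  qed
  show "\<phi> x = 0" using assms(2) by (intro zero) simp
  have "(\<phi> has_field_derivative 0) (at x)"
  proof (rule has_field_derivative_transform_within_open)
    show "((\<lambda>_. 0) has_field_derivative 0) (at x)" "open ?N" "x \<in> ?N"
      using assms(2) by (simp_all add: open_Compl)
    show "0 = \<phi> y" if "y \<in> ?N" for y
      using zero[OF that] by simp
  qed
  then show "deriv \<phi> x = 0" by (rule DERIV_imp_deriv)
qed

text \<open>Products with a test function have compact support in \<open>I\<close>, so both integrals may be taken over a
fixed large interval, where integration by parts has no boundary terms.\<close>

lemma has_weak_deriv_on_C1:
  assumes w: "\<And>x. (w has_real_derivative w' x) (at x)" and w': "continuous_on UNIV w'"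
  shows "has_weak_deriv_on w w' I"
  unfolding has_weak_deriv_on_def
proof (intro allI impI)
  fix \<phi> assume test: "test_fun_on I \<phi>"
  let ?K = "closure {x. \<phi> x \<noteq> 0}"
  have smooth: "(deriv ^^ k) \<phi> field_differentiable at x" for k x
    using test by (simp add: test_fun_on_def)
  have \<phi>: "(\<phi> has_real_derivative deriv \<phi> x) (at x)" for x
    using smooth[of 0 x] by (simp add: DERIV_deriv_iff_field_differentiable)
  have "isCont (deriv \<phi>) x" for x
    using smooth[of 1 x] by (simp add: field_differentiable_imp_continuous_at)
  then have cont_\<phi>': "continuous_on UNIV (deriv \<phi>)"
    by (simp add: continuous_on_eq_continuous_at)
  have cont_\<phi>: "continuous_on UNIV \<phi>"
    using DERIV_isCont[OF \<phi>] by (simp add: continuous_on_eq_continuous_at)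
  have cont_w: "continuous_on UNIV w"
    using DERIV_isCont[OF w] by (simp add: continuous_on_eq_continuous_at)
  have "bounded ?K" "?K \<subseteq> I"
    using test by (auto simp: test_fun_on_def compact_imp_bounded)
  then obtain R where R: "R > 0" "?K \<subseteq> ball 0 R"
    using bounded_subset_ballD by blast
  have supp: "\<phi> x = 0" "deriv \<phi> x = 0" if "x \<notin> I \<or> x \<notin> {-R<..<R}" for x
    proof -
    have "x \<notin> ?K" using that \<open>?K \<subseteq> I\<close> R(2) by (force simp: dist_real_def)
    then show "\<phi> x = 0" "deriv \<phi> x = 0" using test_fun_on_eq_0[OF test] by blast+
  qed
  have on_interval: "(LINT x:I|lebesgue. f x) = (LINT x:{-R..R}|lborel. f x)"
    if "continuous_on UNIV f" "\<And>x. x \<notin> I \<or> x \<notin> {-R<..<R} \<Longrightarrow> f x = 0" for f :: "real \<Rightarrow> real"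
  proof -
    have eq: "indicator I x *\<^sub>R f x = f x" "indicator {-R..R} x *\<^sub>R f x = f x" for x
      using that(2)[of x] by (cases "x \<in> I \<and> x \<in> {-R<..<R}"; force simp: indicator_def)+
    have "f \<in> borel_measurable borel"
      using that(1) by (rule borel_measurable_continuous_onI)
    then show ?thesis
      unfolding set_lebesgue_integral_def eq by (simp add: integral_completion)
  qed
  have int: "set_integrable lborel {-R..R} f" if "continuous_on UNIV f" for f :: "real \<Rightarrow> real"
    using that by (intro borel_integrable_atLeastAtMost') (rule continuous_on_subset, auto)
  \<comment> \<open>The integrand is the derivative of \<open>w x * \<phi> x\<close>, which vanishes at both end points.\<close>
  have "(LINT x:{-R..R}|lborel. w x * deriv \<phi> x + w' x * \<phi> x) = w R * \<phi> R - w (-R) * \<phi> (-R)"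
    unfolding set_lebesgue_integral_def
  proof (rule integral_FTC_atLeastAtMost)
    show "((\<lambda>x. w x * \<phi> x) has_vector_derivative w x * deriv \<phi> x + w' x * \<phi> x)
        (at x within {-R..R})" for x
      using DERIV_mult[OF w \<phi>, of x]
      by (auto simp: has_real_derivative_iff_has_vector_derivative algebra_simps
          intro: has_vector_derivative_at_within)
    show "continuous_on {-R..R} (\<lambda>x. w x * deriv \<phi> x + w' x * \<phi> x)"
      using cont_w cont_\<phi> cont_\<phi>' w' by (auto intro!: continuous_intros intro: continuous_on_subset)
  qed (use R in simp)
  also have "\<dots> = 0" by (simp add: supp)
  finally have "(LINT x:{-R..R}|lborel. w x * deriv \<phi> x) + (LINT x:{-R..R}|lborel. w' x * \<phi> x) = 0"
    using cont_w cont_\<phi> cont_\<phi>' w'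
    by (subst (asm) set_integral_add) (auto intro!: int continuous_intros)
  then show "(LINT x:I|lebesgue. w x * deriv \<phi> x) = - (LINT x:I|lebesgue. w' x * \<phi> x)"
    using cont_w cont_\<phi> cont_\<phi>' w' supp
    by (subst (1 2) on_interval) (auto intro!: continuous_intros)
qed

lemma L2_on_continuous:
  assumes "continuous_on UNIV w" and "integrable lborel (\<lambda>x. (w x)\<^sup>2)" and "I \<in> sets borel"
  shows "L2_on I w"
proof -
  have w: "w \<in> borel_measurable borel"
    using assms(1) by (rule borel_measurable_continuous_onI)
  then have "w \<in> borel_measurable lebesgue"
    by (intro measurable_completion) simp
  moreover have "integrable lebesgue (\<lambda>x. (w x)\<^sup>2)"
    using assms(2) w by (subst integrable_completion) auto
  moreover have "I \<in> sets lebesgue" using assms(3) by auto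
  ultimately show ?thesis
    unfolding L2_on_def set_borel_measurable_def set_integrable_def
    using integrable_mult_indicator[of I lebesgue "\<lambda>x. (w x)\<^sup>2"]
    by (auto intro!: borel_measurable_scaleR)
qed

text \<open>Membership in \<open>H\<^sup>1(I)\<close> depends only on the values on \<open>I\<close>, because every integral in the definition
carries the indicator function of \<open>I\<close>.\<close>

lemma H1_on_cong:
  assumes "w \<in> H1_on I" and "\<And>x. x \<in> I \<Longrightarrow> u x = w x"
  shows "u \<in> H1_on I"
proof -
  have "(\<lambda>x. indicator I x *\<^sub>R f (u x) x) = (\<lambda>x. indicator I x *\<^sub>R f (w x) x)"
    for f :: "real \<Rightarrow> real \<Rightarrow> real"
    using assms(2) by (auto simp: fun_eq_iff indicator_def)
  from this[of "\<lambda>y _. y"] this[of "\<lambda>y _. y\<^sup>2"] this[of "\<lambda>y x. y * g x" for g]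
  show ?thesis
    using assms(1) unfolding H1_on_def L2_on_def has_weak_deriv_on_def
      set_borel_measurable_def set_integrable_def set_lebesgue_integral_def by simp
qed

lemma integrable_dominated_inverse_square:
  fixes f :: "real \<Rightarrow> real"
  assumes "continuous_on UNIV f" and "\<And>x. \<bar>f x\<bar> \<le> C / (1 + x\<^sup>2)"
  shows "integrable lborel f"
proof (rule Bochner_Integration.integrable_bound)
  have "integrable lborel (\<lambda>x::real. inverse (1 + x\<^sup>2))"
    using integrable_inverse_1_plus_square by (simp add: set_integrable_def)
  then show "integrable lborel (\<lambda>x::real. C * inverse (1 + x\<^sup>2))" by simp
  show "f \<in> borel_measurable lborel"
    using borel_measurable_continuous_onI[OF assms(1)] by simp
  show "AE x in lborel. norm (f x) \<le> norm (C * inverse (1 + x\<^sup>2))"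
  proof (rule AE_I2)
    fix x
    have "\<bar>f x\<bar> \<le> C * inverse (1 + x\<^sup>2)"
      using assms(2)[of x] by (simp add: divide_inverse)
    then show "norm (f x) \<le> norm (C * inverse (1 + x\<^sup>2))" by simp
  qed
qed

context
  fixes p \<omega> :: real
  assumes p_gt_2: "p > 2" and omega_pos: "\<omega> > 0"
begin

text \<open>The exponential bound is weakened to a rational one, since \<open>1 / (1 + x\<^sup>2)\<close> is a standard integrable
function on the whole line.\<close>

lemma soliton_square_le: "\<exists>C. \<forall>x. (soliton p \<omega> x)\<^sup>2 \<le> C / (1 + x\<^sup>2)"
proof (intro exI allI)
  fix x
  \<comment> \<open>\<open>M\<close> is chosen so that \<open>1 + x\<^sup>2 \<le> M (1 + 2 \<omega> x\<^sup>2)\<close>, the second factor being the Taylor bound for \<open>exp (2 sqrt \<omega> \<bar>x\<bar>)\<close> without its linear term.\<close>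
  define K M where "K = (2 * \<omega> * p) powr (1 / (p - 2))" and "M = 1 + 1 / (2 * \<omega>)"
  have "(soliton p \<omega> x)\<^sup>2 \<le> (K * exp (- sqrt \<omega> * \<bar>x\<bar>))\<^sup>2"
    using soliton_le_exp[OF p_gt_2 omega_pos, of x] soliton_pos[OF p_gt_2 omega_pos, of x]
    by (intro power_mono) (auto simp: K_def)
  also have "\<dots> = K\<^sup>2 / exp (2 * sqrt \<omega> * \<bar>x\<bar>)"
    by (simp add: power_mult_distrib exp_minus field_simps flip: exp_of_nat_mult)
  also have "\<dots> \<le> K\<^sup>2 / ((1 + x\<^sup>2) / M)"
  proof (intro divide_left_mono mult_pos_pos)
    have "1 + x\<^sup>2 \<le> M * (1 + 2 * \<omega> * x\<^sup>2)"
      using omega_pos by (simp add: M_def field_simps)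
    then have "(1 + x\<^sup>2) / M \<le> 1 + (2 * sqrt \<omega> * \<bar>x\<bar>)\<^sup>2 / 2"
      using omega_pos by (simp add: M_def field_simps power_mult_distrib)
    also have "\<dots> \<le> 1 + 2 * sqrt \<omega> * \<bar>x\<bar> + (2 * sqrt \<omega> * \<bar>x\<bar>)\<^sup>2 / 2"
      using omega_pos by simp
    also have "\<dots> \<le> exp (2 * sqrt \<omega> * \<bar>x\<bar>)"
      using omega_pos by (intro exp_lower_Taylor_quadratic) simp
    finally show "(1 + x\<^sup>2) / M \<le> exp (2 * sqrt \<omega> * \<bar>x\<bar>)" .
  qed (use omega_pos in \<open>auto simp: M_def intro!: divide_pos_pos add_pos_nonneg\<close>)
  finally show "(soliton p \<omega> x)\<^sup>2 \<le> K\<^sup>2 * M / (1 + x\<^sup>2)" by simp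
qed

lemma shifted_soliton_in_H1:
  assumes "I \<in> sets borel"
  shows "(\<lambda>x. soliton p \<omega> (x + a)) \<in> H1_on I"
proof -
  note cont = continuous_soliton[OF p_gt_2 omega_pos]
  define d where "d = soliton_deriv p \<omega>"
  have cont_d: "continuous_on UNIV d"
    using DERIV_isCont[OF DERIV_soliton_deriv[OF p_gt_2 omega_pos]]
    by (simp add: d_def continuous_on_eq_continuous_at)
  obtain C where C: "\<And>x. (soliton p \<omega> x)\<^sup>2 \<le> C / (1 + x\<^sup>2)"
    using soliton_square_le by blast
  have "\<bar>(d x)\<^sup>2\<bar> \<le> (\<omega> * C) / (1 + x\<^sup>2)" for x
  proof -
    have "(d x)\<^sup>2 = \<omega> * ((tanh (soliton_rate p \<omega> * x))\<^sup>2 * (soliton p \<omega> x)\<^sup>2)"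
      using omega_pos by (simp add: d_def soliton_deriv_def power_mult_distrib)
    also have "\<dots> \<le> \<omega> * (1 * (C / (1 + x\<^sup>2)))"
      using omega_pos tanh_square_lt_1[of "soliton_rate p \<omega> * x"] C[of x] by (intro mult_left_mono mult_mono) auto
    finally show ?thesis by simp
  qed
  then have int_d: "integrable lborel (\<lambda>x. (d x)\<^sup>2)"
    by (intro integrable_dominated_inverse_square) (auto intro!: continuous_intros cont_d)
  have int: "integrable lborel (\<lambda>x. (soliton p \<omega> x)\<^sup>2)"
    by (rule integrable_dominated_inverse_square[where C = C])
      (use C in \<open>auto intro!: continuous_intros cont\<close>)
  have "L2_on I (\<lambda>x. soliton p \<omega> (x + a))"
    using lborel_integrable_real_affine[OF int, of 1 a] assms
    by (intro L2_on_continuous) (auto intro!: continuous_intros cont simp: add.commute)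
  moreover have "L2_on I (\<lambda>x. d (x + a))"
    using lborel_integrable_real_affine[OF int_d, of 1 a] assms
    by (intro L2_on_continuous) (auto intro!: continuous_on_compose2[OF cont_d] continuous_intros simp: add.commute)
  moreover have "has_weak_deriv_on (\<lambda>x. soliton p \<omega> (x + a)) (\<lambda>x. d (x + a)) I"
  proof (rule has_weak_deriv_on_C1)
    show "((\<lambda>x. soliton p \<omega> (x + a)) has_real_derivative d (x + a)) (at x)" for x
      using DERIV_soliton[OF p_gt_2 omega_pos, of "x + a"]
      by (simp add: DERIV_shift d_def)
    show "continuous_on UNIV (\<lambda>x. d (x + a))"
      by (auto intro!: continuous_on_compose2[OF cont_d] continuous_intros)
  qed
  ultimately show ?thesis by (auto simp: H1_on_def)
qed

end

section \<open>Square integrable functions on a half-line\<close>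

text \<open>A positive lower bound on a set of infinite measure contradicts square integrability there. On a
half-line, this weak form of decay takes the place of a limit at infinity.\<close>

lemma L2_on_small_value:
  assumes "L2_on I u" and "A \<in> sets lebesgue" and "A \<subseteq> I"
    and "emeasure lebesgue A = \<infinity>" and "\<epsilon> > 0" and "\<And>x. x \<in> A \<Longrightarrow> u x > 0"
  shows "\<exists>x\<in>A. u x < \<epsilon>"
proof (rule ccontr)
  assume "\<not> ?thesis"
  then have large: "\<epsilon> \<le> u x" if "x \<in> A" for x using that by force
  have "set_integrable lebesgue A (\<lambda>x. (u x)\<^sup>2)"
    using assms(1-3) by (auto simp: L2_on_def intro: set_integrable_subset)
  then have "set_integrable lebesgue A (\<lambda>_. \<epsilon>\<^sup>2)"
  proof (rule set_integrable_bound)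
    show "set_borel_measurable lebesgue A (\<lambda>_. \<epsilon>\<^sup>2)"
      using assms(2) by (simp add: set_borel_measurable_def)
    show "AE x in lebesgue. x \<in> A \<longrightarrow> norm (\<epsilon>\<^sup>2) \<le> norm ((u x)\<^sup>2)"
      using large assms(5) by (intro AE_I2) (auto intro!: power_mono)
  qed
  then have "integrable lebesgue (\<lambda>x. \<epsilon>\<^sup>2 * indicat_real A x)"
    by (simp add: set_integrable_def mult.commute)
  then have "integrable lebesgue (indicat_real A)"
    using assms(5) by simp
  then have "emeasure lebesgue A < \<infinity>"
    using assms(2) by (simp add: integrable_indicator_iff)
  then show False using assms(4) by simp
qed

lemma emeasure_lebesgue_halfline:
  "emeasure lebesgue {a::real<..} = \<infinity>" "emeasure lebesgue {..<a::real} = \<infinity>"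
proof -
  have "ennreal (real n) \<le> emeasure lborel {a<..}" "ennreal (real n) \<le> emeasure lborel {..<a}" for n
  proof -
    have "emeasure lborel {a<..<a + real n} \<le> emeasure lborel {a<..}"
      "emeasure lborel {a - real n<..<a} \<le> emeasure lborel {..<a}"
      by (intro emeasure_mono; auto)+
    then show "ennreal (real n) \<le> emeasure lborel {a<..}" "ennreal (real n) \<le> emeasure lborel {..<a}"
      by simp_all
  qed
  moreover have "m = \<infinity>" if "\<And>n. ennreal (real n) \<le> m" for m
    using that ennreal_Ex_less_of_nat[of m]
    by (metis ennreal_of_nat_eq_real_of_nat infinity_ennreal_def leD less_top)
  ultimately show "emeasure lebesgue {a<..} = \<infinity>" "emeasure lebesgue {..<a} = \<infinity>"
    by simp_all
qed

section \<open>Positive solutions on a half-line\<close>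

lemma constant_on_halfline:
  fixes f :: "real \<Rightarrow> real"
  assumes "\<And>x. x > 0 \<Longrightarrow> (f has_real_derivative 0) (at x)"
  obtains c where "\<And>x. x > 0 \<Longrightarrow> f x = c"
  using has_field_derivative_zero_constant[of "{0<..}" f] assms
  by (auto intro: DERIV_subset)

text \<open>The factors \<open>d/dx + k\<close> and \<open>d/dx - k\<close> of the operator reduce the equation to first order:
\<open>(w' + k w) exp (- k x)\<close> and \<open>(w' - k w) exp (k x)\<close> are constant. Their product expresses the
energy \<open>w'\<^sup>2 - k\<^sup>2 w\<^sup>2\<close> through the coefficients.\<close>

lemma linear_second_order_ode:
  fixes k :: real
  assumes "k > 0"
    and w: "\<And>x. x > 0 \<Longrightarrow> (w has_real_derivative w' x) (at x)"
    and w': "\<And>x. x > 0 \<Longrightarrow> (w' has_real_derivative k\<^sup>2 * w x) (at x)"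
  obtains A B where "\<And>x. x > 0 \<Longrightarrow> w x = A * exp (k * x) + B * exp (- k * x)"
    and "\<And>x. x > 0 \<Longrightarrow> (w' x)\<^sup>2 = k\<^sup>2 * (w x)\<^sup>2 - 4 * k\<^sup>2 * A * B"
proof -
  have "((\<lambda>x. (w' x + k * w x) * exp (- k * x)) has_real_derivative 0) (at x)" if "x > 0" for x
    using w[OF that] w'[OF that]
    by (auto intro!: derivative_eq_intros simp: algebra_simps power2_eq_square)
  from constant_on_halfline[OF this] obtain a
    where a: "\<And>x. x > 0 \<Longrightarrow> (w' x + k * w x) * exp (- k * x) = a" by blast
  have "((\<lambda>x. (w' x - k * w x) * exp (k * x)) has_real_derivative 0) (at x)" if "x > 0" for x
    using w[OF that] w'[OF that]
    by (auto intro!: derivative_eq_intros simp: algebra_simps power2_eq_square)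
  from constant_on_halfline[OF this] obtain b
    where b: "\<And>x. x > 0 \<Longrightarrow> (w' x - k * w x) * exp (k * x) = b" by blast
  have plus: "w' x + k * w x = a * exp (k * x)" and minus: "w' x - k * w x = b * exp (- k * x)"
    if "x > 0" for x
    using a[OF that] b[OF that] by (simp_all add: exp_minus field_simps)
  show ?thesis
  proof (rule that[of "a / (2 * k)" "- b / (2 * k)"])
    fix x :: real assume x: "x > 0"
    have "2 * k * w x = a * exp (k * x) - b * exp (- k * x)"
      using plus[OF x] minus[OF x] by linarith
    then show "w x = a / (2 * k) * exp (k * x) + - b / (2 * k) * exp (- k * x)"
      using \<open>k > 0\<close> by (simp add: field_simps)
    have "(w' x)\<^sup>2 - k\<^sup>2 * (w x)\<^sup>2 = (w' x + k * w x) * (w' x - k * w x)"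
      by (simp add: power2_eq_square algebra_simps)
    also have "\<dots> = a * b"
      unfolding plus[OF x] minus[OF x] by (simp add: exp_minus)
    finally show "(w' x)\<^sup>2 = k\<^sup>2 * (w x)\<^sup>2 - 4 * k\<^sup>2 * (a / (2 * k)) * (- b / (2 * k))"
      using \<open>k > 0\<close> by (simp add: field_simps power2_eq_square)
  qed
qed

text \<open>The shift \<open>a\<close> balances the two coefficients: \<open>exp (2 k a) = A / B\<close>.\<close>

lemma exp_combination_eq_cosh:
  fixes k :: real
  assumes "k > 0" "A > 0" "B > 0"
  obtains a where "\<And>x. A * exp (k * x) + B * exp (- k * x) = 2 * sqrt (A * B) * cosh (k * (x + a))"
proof -
  define a where "a = ln (A / B) / (2 * k)"
  have ka: "k * a = ln (A / B) / 2" using assms by (simp add: a_def)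
  have "exp (k * a) = sqrt A / sqrt B"
    unfolding ka using assms by (simp add: ln_sqrt[symmetric] real_sqrt_divide)
  then have e: "sqrt (A * B) * exp (k * a) = A" "sqrt (A * B) * exp (- (k * a)) = B"
    using assms by (simp_all add: exp_minus real_sqrt_mult)
  have "2 * sqrt (A * B) * cosh (k * (x + a)) = A * exp (k * x) + B * exp (- k * x)" for x
  proof -
    have "2 * sqrt (A * B) * cosh (k * (x + a))
        = sqrt (A * B) * exp (k * a) * exp (k * x) + sqrt (A * B) * exp (- (k * a)) * exp (- k * x)"
    proof -
      have "exp (k * (x + a)) = exp (k * a) * exp (k * x)"
        "exp (- (k * (x + a))) = exp (- (k * a)) * exp (- k * x)"
        by (simp_all add: algebra_simps flip: exp_add)
      then show ?thesis by (simp add: cosh_def distrib_left)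
    qed
    then show ?thesis unfolding e .
  qed
  then show ?thesis using that by metis
qed

text \<open>A positive solution on the right half-line. Integrability is expressed by the assumption that
small values occur arbitrarily far out; in this form, the reflection of a solution on the left
half-line is again an instance.\<close>

locale halfline_profile =
  fixes p \<omega> :: real and u u' :: "real \<Rightarrow> real"
  assumes p_gt_2: "p > 2" and omega_pos: "\<omega> > 0"
    and pos: "x > 0 \<Longrightarrow> u x > 0"
    and deriv1: "x > 0 \<Longrightarrow> (u has_real_derivative u' x) (at x)"
    and deriv2: "x > 0 \<Longrightarrow> (u' has_real_derivative \<omega> * u x - u x powr (p - 2) * u x) (at x)"
    and small: "\<epsilon> > 0 \<Longrightarrow> \<exists>x>X. u x < \<epsilon>"
begin

lemma energy_conserved:
  obtains E where "\<And>x. x > 0 \<Longrightarrow> (u' x)\<^sup>2 = E + \<omega> * (u x)\<^sup>2 - 2 / p * (u x)\<^sup>2 * u x powr (p - 2)"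
proof -
  have "((\<lambda>x. (u' x)\<^sup>2 - \<omega> * (u x)\<^sup>2 + 2 / p * u x powr p) has_real_derivative 0) (at x)"
    if x: "x > 0" for x
  proof -
    have "((\<lambda>x. (u' x)\<^sup>2 - \<omega> * (u x)\<^sup>2 + 2 / p * u x powr p) has_real_derivative
        2 * u' x * (\<omega> * u x - u x powr (p - 2) * u x) - \<omega> * (2 * u x * u' x)
          + 2 / p * (p * u x powr (p - 1) * u' x)) (at x)"
      using pos[OF x] p_gt_2
      by (auto intro!: derivative_eq_intros deriv1[OF x] deriv2[OF x] simp: powr_diff field_simps)
    moreover have "u x powr (p - 1) = u x powr (p - 2) * u x"
      using pos[OF x] powr_add[of "u x" "p - 2" 1] by simp
    ultimately show ?thesis using p_gt_2 by (simp add: algebra_simps)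
  qed
  from constant_on_halfline[OF this] obtain E
    where E: "\<And>x. x > 0 \<Longrightarrow> (u' x)\<^sup>2 - \<omega> * (u x)\<^sup>2 + 2 / p * u x powr p = E" by blast
  have "u x powr p = (u x)\<^sup>2 * u x powr (p - 2)" if "x > 0" for x
    using pos[OF that] powr_add[of "u x" 2 "p - 2"] by (simp add: powr_numeral)
  then show ?thesis using E that by (force simp: algebra_simps)
qed

text \<open>A value that lies below an earlier and a later one forces a critical point at which \<open>u\<close> is at most
that value. At positive energy there are no critical points with small values, so \<open>u\<close> cannot rise
again after it has become small.\<close>

lemma no_interior_minimum:
  assumes "0 < x" "x < y" "y < z" and less: "u y < u x" "u y < u z"
  obtains m where "0 < m" "u m \<le> u y" "u' m = 0"
proof -
  have "continuous_on {x..z} u"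
    using assms(1) DERIV_isCont[OF deriv1] by (intro continuous_at_imp_continuous_on) auto
  then obtain m where m: "m \<in> {x..z}" "\<And>s. s \<in> {x..z} \<Longrightarrow> u m \<le> u s"
    using continuous_attains_inf[of "{x..z}" u] assms by auto
  have "u m \<le> u y" using m(2)[of y] assms by auto
  then have "x < m" "m < z" using m(1) less by (auto simp: order_less_le)
  moreover have "u' m = 0"
  proof (rule DERIV_local_min)
    show "(u has_real_derivative u' m) (at m)" using deriv1 \<open>x < m\<close> assms by simp
    show "0 < min (m - x) (z - m)" using \<open>x < m\<close> \<open>m < z\<close> by simp
    show "\<forall>s. \<bar>m - s\<bar> < min (m - x) (z - m) \<longrightarrow> u m \<le> u s"
      using m(2) by (auto simp: abs_if split: if_splits)
  qed
  ultimately show ?thesis using assms \<open>u m \<le> u y\<close> by (intro that[of m]) auto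
qed

lemma energy_zero:
  assumes "x > 0"
  shows "(u' x)\<^sup>2 = \<omega> * (u x)\<^sup>2 - 2 / p * (u x)\<^sup>2 * u x powr (p - 2)"
proof -
  obtain E where E: "\<And>x. x > 0 \<Longrightarrow> (u' x)\<^sup>2 = E + \<omega> * (u x)\<^sup>2 - 2 / p * (u x)\<^sup>2 * u x powr (p - 2)"
    using energy_conserved by blast
  have "E \<ge> 0"
  proof (rule ccontr)
    assume "\<not> E \<ge> 0"
    then have "sqrt (- E / \<omega>) > 0" using omega_pos by (simp add: divide_neg_pos)
    from small[OF this, of 0] obtain x where x: "x > 0" "u x < sqrt (- E / \<omega>)" by blast
    then have "(u x)\<^sup>2 < (sqrt (- E / \<omega>))\<^sup>2"
      using pos[of x] by (intro power_strict_mono) auto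
    then have "E + \<omega> * (u x)\<^sup>2 < 0"
      using \<open>\<not> E \<ge> 0\<close> omega_pos by (simp add: divide_nonpos_pos field_simps)
    moreover have "2 / p * (u x)\<^sup>2 * u x powr (p - 2) \<ge> 0" using p_gt_2 by simp
    ultimately have "(u' x)\<^sup>2 < 0" using E[OF x(1)] by linarith
    then show False by simp
  qed
  moreover have "\<not> E > 0"
  proof
    assume "E > 0"
    \<comment> \<open>Below \<open>\<delta>\<close>, the maximum of the soliton, the potential part \<open>\<omega> u\<^sup>2 - (2/p) u\<^sup>p\<close> of \<open>u'\<^sup>2\<close> is nonnegative.\<close>
    define \<delta> where "\<delta> = (\<omega> * p / 2) powr (1 / (p - 2))"
    have "\<delta> > 0" using p_gt_2 omega_pos by (simp add: \<delta>_def)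
    have steep: "(u' x)\<^sup>2 \<ge> E" if "x > 0" "u x < \<delta>" for x
    proof -
      have "u x powr (p - 2) \<le> \<delta> powr (p - 2)"
        using that pos p_gt_2 by (intro powr_mono2) (auto simp: less_imp_le)
      also have "\<dots> = \<omega> * p / 2"
        using p_gt_2 omega_pos by (simp add: \<delta>_def powr_powr)
      finally have "2 / p * (u x)\<^sup>2 * u x powr (p - 2) \<le> 2 / p * (u x)\<^sup>2 * (\<omega> * p / 2)"
        using p_gt_2 by (intro mult_left_mono) auto
      then show ?thesis using E[OF that(1)] p_gt_2 by (simp add: mult.commute)
    qed
    obtain y where y: "y > 1" "u y < min \<delta> (u 1)"
      using small[of "min \<delta> (u 1)" 1] pos[of 1] \<open>\<delta> > 0\<close> by auto
    have below: "u z \<le> u y" if z: "z > y" for z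
    proof (rule ccontr)
      assume "\<not> u z \<le> u y"
      then obtain m where "0 < m" "u m \<le> u y" "u' m = 0"
        using no_interior_minimum[of 1 y z] y z by auto
      then show False using steep[of m] y \<open>E > 0\<close> by simp
    qed
    \<comment> \<open>After \<open>y\<close> the slope is at least \<open>sqrt E\<close> in absolute value, and it is negative at a mean value point because \<open>u z \<le> u y\<close>.\<close>
    have fast: "u z \<le> u y - sqrt E * (z - y)" if z: "z > y" for z
    proof -
      obtain c where c: "y < c" "c < z" "u z - u y = (z - y) * u' c"
        using MVT2[OF z, of u u'] deriv1 y by force
      have "u c < \<delta>" using below[of c] c y by simp
      then have "sqrt E \<le> \<bar>u' c\<bar>" using real_sqrt_le_mono[OF steep[of c]] c y by simp
      moreover have "u' c \<le> 0"
        using below[OF z] c(3) z mult_pos_pos[of "z - y" "u' c"] by linarith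
      ultimately have "(z - y) * u' c \<le> (z - y) * (- sqrt E)"
        using z by (intro mult_left_mono) auto
      then show ?thesis using c(3) by (simp add: mult.commute)
    qed
    have "u (y + u y / sqrt E) \<le> 0"
      using fast[of "y + u y / sqrt E"] pos[of y] y \<open>E > 0\<close> by simp
    moreover have "y + u y / sqrt E > 0"
      using pos[of y] y \<open>E > 0\<close> by (simp add: add_pos_pos)
    ultimately show False using pos[of "y + u y / sqrt E"] by simp
  qed
  ultimately have "E = 0" by simp
  with E[OF assms] show ?thesis by simp
qed

text \<open>With \<open>q = (p - 2)/2\<close>, the power \<open>w = u powr (- q)\<close> is the one for which the nonlinear terms of
\<open>w''\<close>, one from \<open>u''\<close> and one from \<open>u'\<^sup>2\<close> by the energy relation, cancel. The soliton itself
corresponds to a hyperbolic cosine.\<close>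

lemma shifted_soliton:
  obtains a where "\<And>x. x > 0 \<Longrightarrow> u x = soliton p \<omega> (x + a)"
proof -
  define q where "q = (p - 2) / 2"
  have "2 * q = p - 2" by (simp add: q_def)
  then have q: "q > 0" "p = 2 * q + 2" using p_gt_2 by linarith+
  define k where "k = soliton_rate p \<omega>"
  have k: "k > 0" "k = q * sqrt \<omega>" "k\<^sup>2 = q\<^sup>2 * \<omega>"
  proof -
    show "k = q * sqrt \<omega>" unfolding k_def soliton_rate_def q_def ..
    then show "k > 0" "k\<^sup>2 = q\<^sup>2 * \<omega>"
      using q(1) omega_pos by (simp_all add: power_mult_distrib)
  qed
  have powr_q: "(y powr (- q))\<^sup>2 = inverse (y powr (p - 2))" if "y > 0" for y
    using that by (simp add: powr_power q(2) flip: powr_minus)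
  define w where "w x = u x powr (- q)" for x
  define w' where "w' x = - q * u x powr (- q - 1) * u' x" for x
  have "(w has_real_derivative w' x) (at x)" if "x > 0" for x
    unfolding w_def w'_def using pos[OF that]
    by (auto intro!: derivative_eq_intros deriv1[OF that] simp: powr_diff field_simps)
  moreover have "(w' has_real_derivative k\<^sup>2 * w x) (at x)" if x: "x > 0" for x
  proof -
    define f g P where "f = u x" and "g = u' x" and "P = u x powr (- q)"
    have f: "f > 0" using pos[OF x] by (simp add: f_def)
    define V where "V = f powr (p - 2)"
    have pw: "u x powr (- q - 1) = P / f" "u x powr (- q - 2) = P / f\<^sup>2"
      using f by (simp_all add: P_def f_def powr_diff powr_numeral)
    have g2: "g\<^sup>2 = f\<^sup>2 * (\<omega> - 2 / p * V)"
      unfolding g_def f_def V_def energy_zero[OF x] by (simp add: algebra_simps)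
    have d: "((\<lambda>x. u x powr (- q - 1)) has_real_derivative (- q - 1) * u x powr (- q - 2) * g) (at x)"
      using DERIV_fun_powr[OF deriv1[OF x] pos[OF x], of "- q - 1"]
      by (simp add: g_def minus_diff_commute[of q 2])
    have "(w' has_real_derivative
        - q * ((- q - 1) * u x powr (- q - 2) * g) * g
          + - q * u x powr (- q - 1) * (\<omega> * f - V * f)) (at x)"
      using DERIV_mult[OF DERIV_cmult[OF d, of "- q"] deriv2[OF x]]
      unfolding w'_def f_def g_def V_def by (simp add: algebra_simps)
    also have "- q * ((- q - 1) * u x powr (- q - 2) * g) * g
          + - q * u x powr (- q - 1) * (\<omega> * f - V * f)
        = q * (q + 1) * (P / f\<^sup>2) * g\<^sup>2 - q * P * (\<omega> - V)"
      unfolding pw using f by (simp add: field_simps power2_eq_square)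
    also have "\<dots> = q * (q + 1) * P * (\<omega> - 2 / p * V) - q * P * (\<omega> - V)"
      unfolding g2 using f by simp
    \<comment> \<open>The terms with \<open>V\<close> cancel because \<open>2 (q + 1) = p\<close>.\<close>
    also have "\<dots> = q\<^sup>2 * \<omega> * P"
      unfolding q(2) using q(1) by (simp add: field_simps power2_eq_square)
    finally show ?thesis by (simp add: k(3) w_def P_def)
  qed
  ultimately obtain A B where w: "\<And>x. x > 0 \<Longrightarrow> w x = A * exp (k * x) + B * exp (- k * x)"
    and w'2: "\<And>x. x > 0 \<Longrightarrow> (w' x)\<^sup>2 = k\<^sup>2 * (w x)\<^sup>2 - 4 * k\<^sup>2 * A * B"
    using linear_second_order_ode[OF k(1), of w w'] by blast
  \<comment> \<open>Comparing the energy of \<open>w\<close> with the energy relation for \<open>u\<close> at any one point fixes the product of the coefficients.\<close>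
  have AB: "A * B = 1 / (2 * p * \<omega>)"
  proof -
    define f P where "f = u 1" and "P = u 1 powr (- q)"
    have f: "f > 0" using pos by (simp add: f_def)
    have P2: "P\<^sup>2 * f powr (p - 2) = 1"
      using powr_q[OF f] f by (simp add: P_def f_def)
    have "(w' 1)\<^sup>2 = q\<^sup>2 * (P / f)\<^sup>2 * (u' 1)\<^sup>2"
      using f by (simp add: w'_def P_def f_def powr_diff power_mult_distrib power_divide)
    also have "\<dots> = q\<^sup>2 * P\<^sup>2 * (\<omega> - 2 / p * f powr (p - 2))"
      unfolding energy_zero[OF zero_less_one] f_def[symmetric] using f
      by (simp add: field_simps power_divide)
    also have "\<dots> = k\<^sup>2 * P\<^sup>2 - q\<^sup>2 * (2 / p) * (P\<^sup>2 * f powr (p - 2))"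
      by (simp add: k(3) algebra_simps)
    also have "\<dots> = k\<^sup>2 * (w 1)\<^sup>2 - q\<^sup>2 * (2 / p)"
      unfolding P2 by (simp add: w_def P_def)
    finally have "4 * k\<^sup>2 * A * B = q\<^sup>2 * (2 / p)" using w'2[of 1] by simp
    then have "q\<^sup>2 * (4 * \<omega> * (A * B)) = q\<^sup>2 * (2 / p)"
      unfolding k(3) by (simp add: algebra_simps)
    moreover have "q\<^sup>2 \<noteq> 0" using q(1) by simp
    ultimately have "4 * \<omega> * (A * B) = 2 / p"
      using mult_left_cancel by blast
    then show ?thesis using omega_pos p_gt_2 by (simp add: field_simps)
  qed
  have "A > 0 \<and> B > 0"
  proof -
    have "A * B > 0" using AB p_gt_2 omega_pos by simp
    moreover have "A * exp k + B * exp (- k) > 0"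
    proof -
      have "w 1 > 0" using pos[of 1] by (simp add: w_def)
      then show ?thesis using w[of 1] by simp
    qed
    ultimately show ?thesis
      by (smt (verit) exp_gt_zero zero_less_mult_iff)
  qed
  then obtain a where a: "\<And>x. A * exp (k * x) + B * exp (- k * x) = 2 * sqrt (A * B) * cosh (k * (x + a))"
    using exp_combination_eq_cosh[OF k(1)] by metis
  have "u x = soliton p \<omega> (x + a)" if x: "x > 0" for x
  proof -
    have "(w x)\<^sup>2 = 4 * (A * B) * (cosh (k * (x + a)))\<^sup>2"
      unfolding w[OF x] a using \<open>A > 0 \<and> B > 0\<close> by (simp add: power_mult_distrib)
    also have "\<dots> = inverse (\<omega> * p / (2 * (cosh (k * (x + a)))\<^sup>2))"
      unfolding AB by simp
    finally have "\<omega> * p / (2 * (cosh (k * (x + a)))\<^sup>2) = inverse ((w x)\<^sup>2)"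
      by simp
    also have "\<dots> = u x powr (p - 2)"
      using powr_q[OF pos[OF x]] by (simp add: w_def)
    finally have "soliton p \<omega> (x + a) = (u x powr (p - 2)) powr (1 / (p - 2))"
      by (simp add: soliton_def k_def soliton_rate_def)
    then show ?thesis using p_gt_2 pos[OF x] by (simp add: powr_powr)
  qed
  then show ?thesis by (rule that)
qed

end

section \<open>The algebraic system for the hyperbolic tangents\<close>

text \<open>Up to the factor \<open>- sqrt \<omega> (\<omega> p / 2) powr (1 / (p - 2))\<close>, the derivative of the soliton as a
function of \<open>t = tanh (soliton_rate p \<omega> * x)\<close>.\<close>

definition slope_profile :: "real \<Rightarrow> real \<Rightarrow> real" where
  "slope_profile p t = t * (1 - t\<^sup>2) powr (1 / (p - 2))"

text \<open>The system for the pair of hyperbolic tangents, with \<open>c\<close> in the place of \<open>\<beta> sqrt \<omega>\<close>, restricted to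
positive solutions.\<close>

definition jump_pair :: "real \<Rightarrow> real \<Rightarrow> real \<Rightarrow> real \<Rightarrow> bool" where
  "jump_pair p c tp tm \<longleftrightarrow> 0 < tp \<and> tp < 1 \<and> 0 < tm \<and> tm < 1 \<and>
     slope_profile p tp = slope_profile p tm \<and> inverse tp - inverse tm = - c"

context
  fixes p :: real
  assumes p_gt_2: "p > 2"
begin

abbreviation (input) t_peak :: real where
  "t_peak \<equiv> sqrt ((p - 2) / p)"

lemma t_peak_bounds: "0 < t_peak" "t_peak < 1"
  using p_gt_2 by (simp_all add: real_sqrt_lt_1_iff)

lemma slope_profile_minus: "slope_profile p (- t) = - slope_profile p t"
  by (simp add: slope_profile_def)

lemma slope_profile_pos_iff: "slope_profile p t > 0 \<longleftrightarrow> t > 0" if "\<bar>t\<bar> < 1"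
  using that by (auto simp: slope_profile_def zero_less_mult_iff abs_square_less_1 abs_square_eq_1)

lemma continuous_slope_profile: "continuous_on {0..1} (slope_profile p)"
  unfolding slope_profile_def using p_gt_2
  by (intro continuous_intros continuous_on_powr') (auto simp: power_le_one)

lemma DERIV_slope_profile:
  assumes "\<bar>t\<bar> < 1"
  shows "(slope_profile p has_real_derivative
    (1 - t\<^sup>2) powr (1 / (p - 2) - 1) * (p / (p - 2)) * ((p - 2) / p - t\<^sup>2)) (at t)"
proof -
  define s v where "s = 1 / (p - 2)" and "v = 1 - t\<^sup>2"
  have v: "v > 0" using assms by (simp add: v_def abs_square_less_1)
  have "((\<lambda>t. 1 - t\<^sup>2) has_real_derivative - 2 * t) (at t)"
    by (auto intro!: derivative_eq_intros)
  from DERIV_fun_powr[OF this, of s] v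
  have "((\<lambda>t. (1 - t\<^sup>2) powr s) has_real_derivative s * v powr (s - 1) * (- 2 * t)) (at t)"
    by (simp add: v_def)
  from DERIV_mult[OF DERIV_ident this]
  have "((\<lambda>t. t * (1 - t\<^sup>2) powr s) has_real_derivative
      v powr s + s * v powr (s - 1) * (- 2 * t) * t) (at t)"
    by (simp add: v_def)
  also have "v powr s = v powr (s - 1) * v"
    using v powr_add[of v "s - 1" 1] by simp
  also have "v powr (s - 1) * v + s * v powr (s - 1) * (- 2 * t) * t
      = v powr (s - 1) * (p / (p - 2)) * ((p - 2) / p - t\<^sup>2)"
    using p_gt_2 by (simp add: s_def v_def field_simps power2_eq_square)
  finally show ?thesis
    unfolding v_def s_def slope_profile_def .
qed

lemma slope_profile_increasing:
  assumes "0 \<le> a" "a < b" "b \<le> t_peak"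
  shows "slope_profile p a < slope_profile p b"
proof (rule DERIV_pos_imp_increasing_open[OF assms(2)])
  fix t assume t: "a < t" "t < b"
  then have "\<bar>t\<bar> < 1" using assms t_peak_bounds by linarith
  moreover have "t\<^sup>2 < t_peak\<^sup>2" using t assms by (intro power_strict_mono) auto
  ultimately have "0 < (1 - t\<^sup>2) powr (1 / (p - 2) - 1) * (p / (p - 2)) * ((p - 2) / p - t\<^sup>2)"
    using p_gt_2 abs_square_less_1[of t] by (intro mult_pos_pos divide_pos_pos) auto
  with DERIV_slope_profile[OF \<open>\<bar>t\<bar> < 1\<close>]
  show "\<exists>y. (slope_profile p has_real_derivative y) (at t) \<and> 0 < y" by blast
next
  show "continuous_on {a..b} (slope_profile p)"
  proof (rule continuous_on_subset[OF continuous_slope_profile])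
    have "0 \<le> a" "b \<le> 1" using assms t_peak_bounds by linarith+
    then show "{a..b} \<subseteq> {0..1}" by auto
  qed
qed

lemma slope_profile_decreasing:
  assumes "t_peak \<le> a" "a < b" "b \<le> 1"
  shows "slope_profile p b < slope_profile p a"
proof (rule DERIV_neg_imp_decreasing_open[OF assms(2)])
  fix t assume t: "a < t" "t < b"
  then have "\<bar>t\<bar> < 1" using assms t_peak_bounds by linarith
  moreover have "t_peak\<^sup>2 < t\<^sup>2" using t assms t_peak_bounds by (intro power_strict_mono) auto
  ultimately have "(1 - t\<^sup>2) powr (1 / (p - 2) - 1) * (p / (p - 2)) * ((p - 2) / p - t\<^sup>2) < 0"
    using p_gt_2 abs_square_less_1[of t] by (intro mult_pos_neg mult_pos_pos divide_pos_pos) auto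
  with DERIV_slope_profile[OF \<open>\<bar>t\<bar> < 1\<close>]
  show "\<exists>y. (slope_profile p has_real_derivative y) (at t) \<and> y < 0" by blast
next
  show "continuous_on {a..b} (slope_profile p)"
  proof (rule continuous_on_subset[OF continuous_slope_profile])
    have "0 \<le> a" "b \<le> 1" using assms t_peak_bounds by linarith+
    then show "{a..b} \<subseteq> {0..1}" by auto
  qed
qed

lemma jump_pair_inverse: "jump_pair p c tp tm \<Longrightarrow> inverse tp = inverse tm - c"
  unfolding jump_pair_def by linarith

text \<open>The condition on the reciprocals gives \<open>tm < tp\<close>; two points with the same value cannot lie on the
same monotone branch of the profile.\<close>

lemma jump_pair_separated:
  assumes "c > 0" "jump_pair p c tp tm"
  shows "tm < t_peak" "t_peak < tp"
proof -
  have "inverse tp < inverse tm" using assms(1) jump_pair_inverse[OF assms(2)] by linarith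
  then have less: "tm < tp" using assms(2) by (simp add: jump_pair_def inverse_less_iff_less)
  show "t_peak < tp"
    using slope_profile_increasing[of tm tp] less assms(2) by (force simp: jump_pair_def)
  show "tm < t_peak"
    using slope_profile_decreasing[of tm tp] less assms(2) by (force simp: jump_pair_def)
qed

text \<open>If \<open>tm\<close> increases along its branch, then \<open>tp\<close>, which has the same profile value on the decreasing
branch, decreases, and \<open>inverse tp - inverse tm\<close> strictly increases. So this difference attains the
value \<open>- c\<close> at most once.\<close>

lemma jump_pair_not_less:
  assumes "c > 0" "jump_pair p c tp tm" "jump_pair p c tp' tm'"
  shows "\<not> tm < tm'"
proof
  assume less: "tm < tm'"
  note bounds = jump_pair_separated[OF assms(1,2)] jump_pair_separated[OF assms(1,3)]
  have "slope_profile p tm < slope_profile p tm'"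
    using less bounds assms by (intro slope_profile_increasing) (auto simp: jump_pair_def)
  then have "slope_profile p tp < slope_profile p tp'"
    using assms by (simp add: jump_pair_def)
  then have "tp' < tp"
    using slope_profile_decreasing[of tp tp'] bounds assms(3)
    by (cases tp tp' rule: linorder_cases) (auto simp: jump_pair_def)
  then have "inverse tp < inverse tp'" "inverse tm' < inverse tm"
    using less assms by (auto simp: jump_pair_def)
  then show False
    using jump_pair_inverse[OF assms(2)] jump_pair_inverse[OF assms(3)] by linarith
qed

lemma jump_pair_unique:
  assumes "c > 0" "jump_pair p c tp tm" "jump_pair p c tp' tm'"
  shows "tp' = tp" "tm' = tm"
proof -
  show "tm' = tm"
    using jump_pair_not_less[OF assms] jump_pair_not_less[OF assms(1,3,2)] by simp
  then have "inverse tp' = inverse tp"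
    using jump_pair_inverse[OF assms(2)] jump_pair_inverse[OF assms(3)] by metis
  then show "tp' = tp" by simp
qed

text \<open>The pairs with the prescribed difference of reciprocals are \<open>(1/a, 1/(a + c))\<close>. As \<open>a\<close> runs from
\<open>1\<close>, where the profile vanishes, to the reciprocal of its maximum point, the difference of the
profile values changes sign.\<close>

lemma jump_pair_exists:
  assumes "c > 0"
  obtains tp tm where "jump_pair p c tp tm"
proof -
  define F where "F a = slope_profile p (inverse a) - slope_profile p (inverse (a + c))" for a
  have "F 1 < 0"
  proof -
    have "slope_profile p 1 = 0" by (simp add: slope_profile_def)
    moreover have "slope_profile p (inverse (1 + c)) > 0"
      using assms slope_profile_pos_iff[of "inverse (1 + c)"] by (simp add: inverse_less_1_iff)
    ultimately show ?thesis by (simp add: F_def)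
  qed
  moreover have "F (inverse t_peak) > 0"
  proof -
    have "inverse (inverse t_peak + c) < inverse (inverse t_peak)"
      using assms t_peak_bounds by (intro less_imp_inverse_less) auto
    then show ?thesis
      using slope_profile_increasing[of "inverse (inverse t_peak + c)" t_peak] assms t_peak_bounds
      by (simp add: F_def)
  qed
  moreover have "1 \<le> inverse t_peak"
    using t_peak_bounds by (intro one_le_inverse) auto
  moreover have "continuous_on {1..inverse t_peak} F"
    unfolding F_def using assms
    by (auto intro!: continuous_intros continuous_on_compose2[OF continuous_slope_profile]
        simp: inverse_le_1_iff)
  ultimately obtain a where a: "1 \<le> a" "F a = 0"
    using IVT'[of F 1 0 "inverse t_peak"] by force
  with \<open>F 1 < 0\<close> have "a > 1" by (cases "a = 1") auto
  have "jump_pair p c (inverse a) (inverse (a + c))"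
    using a \<open>a > 1\<close> assms by (simp add: jump_pair_def F_def inverse_less_1_iff)
  then show ?thesis by (rule that)
qed

text \<open>For nonzero \<open>ta\<close>, the jump condition divided by the common value of the profile is the condition on
the reciprocals. The profile has the sign of its argument, so both tangents are positive, which
leaves only \<open>jump_pair\<close>, or both are negative, which reduces to it by \<open>(ta, tb) \<mapsto> (- tb, - ta)\<close>.\<close>

lemma matching_conditions_tanh:
  fixes ta tb c :: real
  assumes c: "c > 0" and ta: "\<bar>ta\<bar> < 1" and tb: "\<bar>tb\<bar> < 1"
    and pair: "jump_pair p c tp tm"
  shows "slope_profile p ta = slope_profile p tb \<and>
      (1 - ta\<^sup>2) powr (1 / (p - 2)) - (1 - tb\<^sup>2) powr (1 / (p - 2)) = - c * slope_profile p ta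
    \<longleftrightarrow> (ta, tb) \<in> {(0, 0), (tp, tm), (- tm, - tp)}"
    (is "?L \<longleftrightarrow> ?R")
proof -
  define G where "G t = (1 - t\<^sup>2) powr (1 / (p - 2))" for t :: real
  have g: "slope_profile p t = t * G t" for t by (simp add: slope_profile_def G_def)
  have pos: "G ta > 0" "G tb > 0" using ta tb by (simp_all add: G_def abs_square_less_1 abs_square_eq_1)
  have jump: "G ta - G tb = - c * (ta * G ta) \<longleftrightarrow> inverse ta - inverse tb = - c"
    if "ta \<noteq> 0" "ta * G ta = tb * G tb"
  proof -
    have "tb \<noteq> 0" using that pos by auto
    have "G ta - G tb = ta * G ta * inverse ta - tb * G tb * inverse tb"
      using \<open>ta \<noteq> 0\<close> \<open>tb \<noteq> 0\<close> by (simp add: field_simps)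
    also have "\<dots> = ta * G ta * (inverse ta - inverse tb)"
      unfolding that(2) by (simp add: right_diff_distrib)
    finally have "G ta - G tb = - c * (ta * G ta)
        \<longleftrightarrow> ta * G ta * (inverse ta - inverse tb) = ta * G ta * - c" by (simp add: mult.commute)
    moreover have nz: "ta * G ta \<noteq> 0" using that(1) pos(1) by simp
    ultimately show ?thesis by (simp only: mult_left_cancel[OF nz])
  qed
  have "?R" if ?L
  proof (cases "ta = 0")
    case True
    then show ?thesis using that pos by (auto simp: g)
  next
    case False
    have eq: "slope_profile p ta = slope_profile p tb" and inv: "inverse ta - inverse tb = - c"
      using that False jump by (auto simp: g G_def)
    have same_sign: "ta > 0 \<longleftrightarrow> tb > 0"
      using slope_profile_pos_iff[OF ta] slope_profile_pos_iff[OF tb] eq by simp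
    show ?thesis
    proof (cases "ta > 0")
      case True
      then have "jump_pair p c ta tb"
        using same_sign eq inv ta tb by (simp add: jump_pair_def)
      then show ?thesis using jump_pair_unique[OF c pair] by simp
    next
      case f: False
      have "tb \<noteq> 0" using eq False pos by (auto simp: g)
      then have "jump_pair p c (- tb) (- ta)"
        using f False same_sign eq inv ta tb
        by (simp add: jump_pair_def slope_profile_minus)
      then show ?thesis using jump_pair_unique[OF c pair] by force
    qed
  qed
  moreover have ?L if ?R
    using that
  proof (elim insertE emptyE)
    assume "(ta, tb) = (tp, tm)"
    then show ?L using pair jump by (auto simp: jump_pair_def g G_def)
  next
    assume "(ta, tb) = (- tm, - tp)"
    then show ?L using pair jump by (auto simp: jump_pair_def g G_def)
  qed (simp add: slope_profile_def)
  ultimately show ?thesis by blast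
qed

end

section \<open>Gluing two shifted solitons at the origin\<close>

context
  fixes p \<omega> :: real
  assumes p_gt_2: "p > 2" and omega_pos: "\<omega> > 0"
begin

lemma soliton_limits:
  "((\<lambda>x. soliton p \<omega> (x + a)) \<longlongrightarrow> soliton p \<omega> a) (at 0 within S)"
  "((\<lambda>x. soliton_deriv p \<omega> (x + a)) \<longlongrightarrow> soliton_deriv p \<omega> a) (at 0 within S)"
proof -
  have "((\<lambda>x. x + a) \<longlongrightarrow> a) (at 0 within S)" by (auto intro!: tendsto_eq_intros)
  from isCont_tendsto_compose[OF DERIV_isCont[OF DERIV_soliton[OF p_gt_2 omega_pos]] this]
    isCont_tendsto_compose[OF DERIV_isCont[OF DERIV_soliton_deriv[OF p_gt_2 omega_pos]] this]
  show "((\<lambda>x. soliton p \<omega> (x + a)) \<longlongrightarrow> soliton p \<omega> a) (at 0 within S)"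
    "((\<lambda>x. soliton_deriv p \<omega> (x + a)) \<longlongrightarrow> soliton_deriv p \<omega> a) (at 0 within S)" .
qed

lemma eventually_one_sided:
  "\<forall>\<^sub>F x in at_right (0::real). x > 0" "\<forall>\<^sub>F x in at_left (0::real). x < 0"
  by (auto simp: eventually_at_filter)

lemma shifted_solitons_limits:
  "(shifted_solitons p \<omega> a b \<longlongrightarrow> soliton p \<omega> a) (at_right 0)"
  "(shifted_solitons p \<omega> a b \<longlongrightarrow> soliton p \<omega> b) (at_left 0)"
proof -
  have "\<forall>\<^sub>F x in at_right 0. soliton p \<omega> (x + a) = shifted_solitons p \<omega> a b x"
    using eventually_one_sided(1) by eventually_elim (simp add: shifted_solitons_def)
  from Lim_transform_eventually[OF soliton_limits(1) this]
  show "(shifted_solitons p \<omega> a b \<longlongrightarrow> soliton p \<omega> a) (at_right 0)" .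
  have "\<forall>\<^sub>F x in at_left 0. soliton p \<omega> (x + b) = shifted_solitons p \<omega> a b x"
    using eventually_one_sided(2) by eventually_elim (simp add: shifted_solitons_def)
  from Lim_transform_eventually[OF soliton_limits(1) this]
  show "(shifted_solitons p \<omega> a b \<longlongrightarrow> soliton p \<omega> b) (at_left 0)" .
qed

lemma DERIV_shifted_solitons:
  assumes "x \<noteq> 0"
  shows "(shifted_solitons p \<omega> a b has_real_derivative
      soliton_deriv p \<omega> (x + (if x > 0 then a else b))) (at x)"
proof (rule has_field_derivative_transform_within_open)
  let ?c = "if x > 0 then a else b" and ?S = "if x > 0 then {0::real<..} else {..<0}"
  show "((\<lambda>y. soliton p \<omega> (y + ?c)) has_real_derivative soliton_deriv p \<omega> (x + ?c)) (at x)"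
    using DERIV_soliton[OF p_gt_2 omega_pos, of "x + ?c"] by (simp add: DERIV_shift)
  show "open ?S" "x \<in> ?S" using assms by auto
  show "soliton p \<omega> (y + ?c) = shifted_solitons p \<omega> a b y" if "y \<in> ?S" for y
    using that by (auto simp: shifted_solitons_def split: if_splits)
qed

lemma deriv_shifted_solitons:
  assumes "x \<noteq> 0"
  shows "deriv (shifted_solitons p \<omega> a b) x = soliton_deriv p \<omega> (x + (if x > 0 then a else b))"
  by (rule DERIV_imp_deriv[OF DERIV_shifted_solitons[OF assms]])

lemma DERIV_deriv_shifted_solitons:
  fixes a b x :: real
  assumes "x \<noteq> 0"
  defines "u \<equiv> shifted_solitons p \<omega> a b"
  shows "(deriv u has_real_derivative \<omega> * u x - u x powr (p - 2) * u x) (at x)"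
proof (rule has_field_derivative_transform_within_open)
  let ?c = "if x > 0 then a else b" and ?S = "if x > 0 then {0::real<..} else {..<0}"
  have "u x = soliton p \<omega> (x + ?c)" using assms by (simp add: u_def shifted_solitons_def)
  then show "((\<lambda>y. soliton_deriv p \<omega> (y + ?c)) has_real_derivative
      \<omega> * u x - u x powr (p - 2) * u x) (at x)"
    using DERIV_soliton_deriv[OF p_gt_2 omega_pos, of "x + ?c"] by (simp add: DERIV_shift)
  show "open ?S" "x \<in> ?S" using assms by auto
  show "soliton_deriv p \<omega> (y + ?c) = deriv u y" if "y \<in> ?S" for y
    using that deriv_shifted_solitons[of y a b] by (auto simp: u_def split: if_splits)
qed

lemma deriv_shifted_solitons_limits:
  "(deriv (shifted_solitons p \<omega> a b) \<longlongrightarrow> soliton_deriv p \<omega> a) (at_right 0)"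
  "(deriv (shifted_solitons p \<omega> a b) \<longlongrightarrow> soliton_deriv p \<omega> b) (at_left 0)"
proof -
  have "\<forall>\<^sub>F x in at_right 0. soliton_deriv p \<omega> (x + a) = deriv (shifted_solitons p \<omega> a b) x"
    using eventually_one_sided(1) by eventually_elim (simp add: deriv_shifted_solitons)
  from Lim_transform_eventually[OF soliton_limits(2) this]
  show "(deriv (shifted_solitons p \<omega> a b) \<longlongrightarrow> soliton_deriv p \<omega> a) (at_right 0)" .
  have "\<forall>\<^sub>F x in at_left 0. soliton_deriv p \<omega> (x + b) = deriv (shifted_solitons p \<omega> a b) x"
    using eventually_one_sided(2) by eventually_elim (simp add: deriv_shifted_solitons)
  from Lim_transform_eventually[OF soliton_limits(2) this]
  show "(deriv (shifted_solitons p \<omega> a b) \<longlongrightarrow> soliton_deriv p \<omega> b) (at_left 0)" .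
qed

lemma shifted_solitons_pos: "x \<noteq> 0 \<Longrightarrow> shifted_solitons p \<omega> a b x > 0"
  using soliton_pos[OF p_gt_2 omega_pos] by (simp add: shifted_solitons_def)

text \<open>The equation always holds off the origin. The one-sided limits exist and are unique, so the
existential quantifiers over them reduce to the values of the soliton and its derivative.\<close>

lemma shifted_solitons_solve_iff:
  "solves_system \<beta> p \<omega> (shifted_solitons p \<omega> a b) \<longleftrightarrow>
     soliton_deriv p \<omega> a = soliton_deriv p \<omega> b \<and>
     soliton p \<omega> a - soliton p \<omega> b = \<beta> * soliton_deriv p \<omega> a"
    (is "solves_system \<beta> p \<omega> ?u \<longleftrightarrow> ?match")
proof -
  have equation: "?u field_differentiable at x \<and> deriv ?u field_differentiable at x \<and>
      - deriv (deriv ?u) x + \<omega> * ?u x - \<bar>?u x\<bar> powr (p - 2) * ?u x = 0" if "x \<noteq> 0" for x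
    using DERIV_shifted_solitons[OF that, of a b] DERIV_deriv_shifted_solitons[OF that, of a b]
      DERIV_imp_deriv[OF DERIV_deriv_shifted_solitons[OF that, of a b]]
      shifted_solitons_pos[OF that, of a b]
    by (auto simp: field_differentiable_def)
  have "ur = soliton p \<omega> a \<and> ul = soliton p \<omega> b \<and> dr = soliton_deriv p \<omega> a \<and> dl = soliton_deriv p \<omega> b
    \<longleftrightarrow> (?u \<longlongrightarrow> ur) (at_right 0) \<and> (?u \<longlongrightarrow> ul) (at_left 0) \<and>
        (deriv ?u \<longlongrightarrow> dr) (at_right 0) \<and> (deriv ?u \<longlongrightarrow> dl) (at_left 0)" for ur ul dr dl
    using shifted_solitons_limits[of a b] deriv_shifted_solitons_limits[of a b]
      tendsto_unique[OF trivial_limit_at_right_real] tendsto_unique[OF trivial_limit_at_left_real]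
    by metis
  then have "(\<exists>ur ul dr dl. (?u \<longlongrightarrow> ur) (at_right 0) \<and> (?u \<longlongrightarrow> ul) (at_left 0) \<and>
        (deriv ?u \<longlongrightarrow> dr) (at_right 0) \<and> (deriv ?u \<longlongrightarrow> dl) (at_left 0) \<and>
        dr = dl \<and> ur - ul = \<beta> * dr) \<longleftrightarrow> ?match"
    by metis
  then show ?thesis
    using equation by (simp add: solves_system_def)
qed

lemma shifted_solitons_in_H1_split: "shifted_solitons p \<omega> a b \<in> H1_split"
proof -
  have "shifted_solitons p \<omega> a b \<in> H1_on {..<0}"
    by (rule H1_on_cong[OF shifted_soliton_in_H1[OF p_gt_2 omega_pos, of _ b]])
      (auto simp: shifted_solitons_def)
  moreover have "shifted_solitons p \<omega> a b \<in> H1_on {0<..}"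
    by (rule H1_on_cong[OF shifted_soliton_in_H1[OF p_gt_2 omega_pos, of _ a]])
      (auto simp: shifted_solitons_def)
  ultimately show ?thesis by (simp add: H1_split_def shifted_solitons_def)
qed

text \<open>The half-line result applies to \<open>u\<close> and to \<open>x \<mapsto> u (- x)\<close>; evenness of the soliton turns the second
translate into a translate on the left half-line, with the opposite shift.\<close>

lemma positive_solution_is_shifted_solitons:
  assumes "u \<in> positive_solutions \<beta> p \<omega>"
  obtains a b where "u = shifted_solitons p \<omega> a b"
proof -
  have ext: "u \<in> extensional (- {0})" and L2: "L2_on {..<0} u" "L2_on {0<..} u"
    and pos: "\<And>x. x \<noteq> 0 \<Longrightarrow> u x > 0"
    and d1: "\<And>x. x \<noteq> 0 \<Longrightarrow> u field_differentiable at x"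
    and d2: "\<And>x. x \<noteq> 0 \<Longrightarrow> deriv u field_differentiable at x"
    and eq: "\<And>x. x \<noteq> 0 \<Longrightarrow> - deriv (deriv u) x + \<omega> * u x - \<bar>u x\<bar> powr (p - 2) * u x = 0"
    using assms by (auto simp: positive_solutions_def H1_split_def H1_on_def solves_system_def)
  have du: "(u has_real_derivative deriv u x) (at x)" if "x \<noteq> 0" for x
    using d1[OF that] by (simp add: DERIV_deriv_iff_field_differentiable)
  have ddu: "(deriv u has_real_derivative \<omega> * u x - u x powr (p - 2) * u x) (at x)" if "x \<noteq> 0" for x
  proof -
    have "deriv (deriv u) x = \<omega> * u x - u x powr (p - 2) * u x"
      using eq[OF that] pos[OF that] by simp
    then show ?thesis
      using d2[OF that] by (simp add: DERIV_deriv_iff_field_differentiable[symmetric])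
  qed
  interpret right: halfline_profile p \<omega> u "deriv u"
  proof
    fix \<epsilon> X :: real assume "\<epsilon> > 0"
    \<comment> \<open>The threshold is kept nonnegative because \<open>u\<close> is only controlled on the half-line itself.\<close>
    have "\<exists>x\<in>{max 0 X<..}. u x < \<epsilon>"
      using pos emeasure_lebesgue_halfline(1)[of "max 0 X"] \<open>\<epsilon> > 0\<close>
      by (intro L2_on_small_value[OF L2(2)]) auto
    then show "\<exists>x>X. u x < \<epsilon>" by auto
  qed (use p_gt_2 omega_pos pos du ddu in auto)
  interpret left: halfline_profile p \<omega> "\<lambda>x. u (- x)" "\<lambda>x. - deriv u (- x)"
  proof
    fix \<epsilon> X :: real assume "\<epsilon> > 0"
    have "\<exists>x\<in>{..<min 0 (- X)}. u x < \<epsilon>"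
      using pos emeasure_lebesgue_halfline(2)[of "min 0 (- X)"] \<open>\<epsilon> > 0\<close>
      by (intro L2_on_small_value[OF L2(1)]) auto
    then obtain x where "x < - X" "u x < \<epsilon>" by auto
    then show "\<exists>x>X. u (- x) < \<epsilon>" by (intro exI[of _ "- x"]) auto
  next
    fix x :: real assume "x > 0"
    then have "- x \<noteq> 0" by simp
    show "((\<lambda>x. u (- x)) has_real_derivative - deriv u (- x)) (at x)"
      using du[OF \<open>- x \<noteq> 0\<close>] by (simp add: DERIV_mirror)
    show "((\<lambda>x. - deriv u (- x)) has_real_derivative
        \<omega> * u (- x) - u (- x) powr (p - 2) * u (- x)) (at x)"
      using DERIV_minus[OF ddu[OF \<open>- x \<noteq> 0\<close>, unfolded DERIV_mirror]] by simp
  qed (use p_gt_2 omega_pos pos in auto)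
  obtain a where a: "\<And>x. x > 0 \<Longrightarrow> u x = soliton p \<omega> (x + a)"
    using right.shifted_soliton by blast
  obtain b where b: "\<And>x. x > 0 \<Longrightarrow> u (- x) = soliton p \<omega> (x + b)"
    using left.shifted_soliton by blast
  have "u x = shifted_solitons p \<omega> a (- b) x" if "x \<noteq> 0" for x
    using that a[of x] b[of "- x"] soliton_minus[of p \<omega> "- x + b"]
    by (cases "x > 0") (auto simp: shifted_solitons_def)
  then have "u = shifted_solitons p \<omega> a (- b)"
    using ext by (intro extensionalityI[of u "- {0}"]) (auto simp: shifted_solitons_def)
  then show ?thesis by (rule that)
qed

lemma positive_solutions_eq:
  "positive_solutions \<beta> p \<omega> = {shifted_solitons p \<omega> a b | a b.
     soliton_deriv p \<omega> a = soliton_deriv p \<omega> b \<and>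
     soliton p \<omega> a - soliton p \<omega> b = \<beta> * soliton_deriv p \<omega> a}"
proof (intro subset_antisym subsetI)
  fix u assume u: "u \<in> positive_solutions \<beta> p \<omega>"
  then obtain a b where ab: "u = shifted_solitons p \<omega> a b"
    using positive_solution_is_shifted_solitons by blast
  have "solves_system \<beta> p \<omega> u" using u by (simp add: positive_solutions_def)
  then show "u \<in> {shifted_solitons p \<omega> a b | a b.
     soliton_deriv p \<omega> a = soliton_deriv p \<omega> b \<and>
     soliton p \<omega> a - soliton p \<omega> b = \<beta> * soliton_deriv p \<omega> a}"
    using ab shifted_solitons_solve_iff by blast
next
  fix u assume "u \<in> {shifted_solitons p \<omega> a b | a b.
     soliton_deriv p \<omega> a = soliton_deriv p \<omega> b \<and>
     soliton p \<omega> a - soliton p \<omega> b = \<beta> * soliton_deriv p \<omega> a}"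
  then show "u \<in> positive_solutions \<beta> p \<omega>"
    using shifted_solitons_solve_iff shifted_solitons_in_H1_split shifted_solitons_pos
    by (auto simp: positive_solutions_def)
qed

lemma matching_conditions_iff:
  assumes "\<beta> > 0" and pair: "jump_pair p (\<beta> * sqrt \<omega>) tp tm"
    and xp: "tp = tanh (soliton_rate p \<omega> * xp)" and xm: "tm = tanh (soliton_rate p \<omega> * xm)"
  shows "soliton_deriv p \<omega> a = soliton_deriv p \<omega> b \<and>
      soliton p \<omega> a - soliton p \<omega> b = \<beta> * soliton_deriv p \<omega> a
    \<longleftrightarrow> (a, b) \<in> {(0, 0), (xp, xm), (- xm, - xp)}"
proof -
  define K where "K = (\<omega> * p / 2) powr (1 / (p - 2))"
  define t where "t x = tanh (soliton_rate p \<omega> * x)" for x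
  have K: "K > 0" using p_gt_2 omega_pos by (simp add: K_def)
  have val: "soliton p \<omega> x = K * (1 - (t x)\<^sup>2) powr (1 / (p - 2))" for x
    unfolding K_def t_def by (rule soliton_tanh[OF p_gt_2 omega_pos])
  have slope: "soliton_deriv p \<omega> x = - (sqrt \<omega> * K) * slope_profile p (t x)" for x
    unfolding soliton_deriv_def val slope_profile_def t_def by simp
  have t_inj: "t x = s \<longleftrightarrow> x = y" if "s = t y" for x y s
    using that soliton_rate_pos[OF p_gt_2 omega_pos] by (simp add: t_def)
  have t_bound: "\<bar>t x\<bar> < 1" for x
    using tanh_real_bounds[of "soliton_rate p \<omega> * x"] by (simp add: t_def abs_less_iff)
  have "soliton_deriv p \<omega> a = soliton_deriv p \<omega> b \<longleftrightarrow> slope_profile p (t a) = slope_profile p (t b)"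
    unfolding slope using K omega_pos by simp
  moreover have "soliton p \<omega> a - soliton p \<omega> b = \<beta> * soliton_deriv p \<omega> a \<longleftrightarrow>
      K * ((1 - (t a)\<^sup>2) powr (1 / (p - 2)) - (1 - (t b)\<^sup>2) powr (1 / (p - 2)))
        = K * (- (\<beta> * sqrt \<omega>) * slope_profile p (t a))"
    unfolding val slope by (simp add: algebra_simps)
  moreover have "\<dots> \<longleftrightarrow> (1 - (t a)\<^sup>2) powr (1 / (p - 2)) - (1 - (t b)\<^sup>2) powr (1 / (p - 2))
        = - (\<beta> * sqrt \<omega>) * slope_profile p (t a)"
    using K by (intro mult_left_cancel) simp
  moreover have "\<beta> * sqrt \<omega> > 0" using assms(1) omega_pos by simp
  note matching_conditions_tanh[OF p_gt_2 this t_bound[of a] t_bound[of b] pair]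
  moreover have "(t a, t b) \<in> {(0, 0), (tp, tm), (- tm, - tp)}
      \<longleftrightarrow> (a, b) \<in> {(0, 0), (xp, xm), (- xm, - xp)}"
  proof -
    have "0 = t 0" "tp = t xp" "tm = t xm" "- tm = t (- xm)" "- tp = t (- xp)"
      by (simp_all add: t_def xp xm)
    then show ?thesis by (simp add: t_inj)
  qed
  ultimately show ?thesis by blast
qed

lemma discontinuous_shifted_solitons:
  assumes "soliton p \<omega> a \<noteq> soliton p \<omega> b"
  shows "discontinuous_at_origin (shifted_solitons p \<omega> a b)"
  unfolding discontinuous_at_origin_def
proof
  assume "\<exists>l. (shifted_solitons p \<omega> a b \<longlongrightarrow> l) (at 0)"
  then obtain l where l: "(shifted_solitons p \<omega> a b \<longlongrightarrow> l) (at 0)" ..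
  have "l = soliton p \<omega> a" "l = soliton p \<omega> b"
    using shifted_solitons_limits[of a b] l
      tendsto_unique[OF trivial_limit_at_right_real] tendsto_unique[OF trivial_limit_at_left_real]
    by (metis filterlim_at_split)+
  with assms show False by simp
qed

end

section \<open>The three positive solutions\<close>

theorem lemma3p1:
  fixes \<beta> p \<omega> :: real
  assumes "\<beta> > 0" and "p > 2" and "\<omega> > 0"
  shows "card (positive_solutions \<beta> p \<omega>) = 3 \<and>
    (\<exists>u1 u2 xp xm tp tm.
       positive_solutions \<beta> p \<omega> = {restrict (soliton p \<omega>) (- {0}), u1, u2} \<and>
       discontinuous_at_origin u1 \<and> discontinuous_at_origin u2 \<and>
       u1 = shifted_solitons p \<omega> xp xm \<and> xp > xm \<and> xm > 0 \<and>
       u2 = (\<lambda>x\<in>- {0}. u1 (- x)) \<and>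
       tp = tanh ((p - 2) / 2 * sqrt \<omega> * xp) \<and>
       tm = tanh ((p - 2) / 2 * sqrt \<omega> * xm) \<and>
       tp * (1 - tp\<^sup>2) powr (1 / (p - 2)) = tm * (1 - tm\<^sup>2) powr (1 / (p - 2)) \<and>
       inverse tp - inverse tm = - \<beta> * sqrt \<omega> \<and>
       0 < tm \<and> tm < sqrt ((p - 2) / p) \<and> sqrt ((p - 2) / p) < tp \<and> tp < 1)"
proof -
  note p = assms(2) and \<omega> = assms(3)
  have c: "\<beta> * sqrt \<omega> > 0" using assms by simp
  obtain tp tm where pair: "jump_pair p (\<beta> * sqrt \<omega>) tp tm"
    using jump_pair_exists[OF p c] by blast
  note separated = jump_pair_separated[OF p c pair]
  define k where "k = soliton_rate p \<omega>"
  have k: "k > 0" using soliton_rate_pos[OF p \<omega>] by (simp add: k_def)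
  define xp xm where "xp = artanh tp / k" and "xm = artanh tm / k"
  have tp: "tp = tanh (k * xp)" and tm: "tm = tanh (k * xm)"
    using pair k by (simp_all add: xp_def xm_def tanh_artanh jump_pair_def)
  have "k * xm < k * xp"
    using separated tp tm tanh_real_less_iff[of "k * xm" "k * xp"] by linarith
  then have "xm < xp" using k by simp
  have "k * xm > 0"
    using pair tm tanh_real_pos_iff[of "k * xm"] by (simp add: jump_pair_def)
  then have "xm > 0" using k by (simp add: zero_less_mult_iff)
  note match = matching_conditions_iff[OF p \<omega> assms(1) pair tp[unfolded k_def] tm[unfolded k_def]]
  define u0 u1 u2 where "u0 = restrict (soliton p \<omega>) (- {0})"
    and "u1 = shifted_solitons p \<omega> xp xm" and "u2 = shifted_solitons p \<omega> (- xm) (- xp)"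
  have u0: "u0 = shifted_solitons p \<omega> 0 0"
    by (auto simp: u0_def shifted_solitons_def fun_eq_iff)
  have u2: "u2 = (\<lambda>x\<in>- {0}. u1 (- x))"
  proof
    fix x
    show "u2 x = (\<lambda>x\<in>- {0}. u1 (- x)) x"
      using soliton_minus[of p \<omega> "x - xm"] soliton_minus[of p \<omega> "x - xp"]
      by (auto simp: u2_def u1_def shifted_solitons_def)
  qed
  have solutions: "positive_solutions \<beta> p \<omega> = {u0, u1, u2}"
    unfolding positive_solutions_eq[OF p \<omega>] match u0 u1_def u2_def by auto
  \<comment> \<open>This strict inequality, the jump of \<open>u1\<close>, gives both the discontinuities and the distinctness of the solutions.\<close>
  have jump: "soliton p \<omega> xp < soliton p \<omega> xm"
  proof -
    have "soliton p \<omega> xp - soliton p \<omega> xm = \<beta> * soliton_deriv p \<omega> xp"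
      using match[of xp xm] by simp
    moreover have "soliton_deriv p \<omega> xp < 0"
      using pair soliton_pos[OF p \<omega>, of xp] \<omega> tp
      by (simp add: soliton_deriv_def k_def jump_pair_def)
    ultimately show ?thesis using assms(1) by (smt (verit) mult_pos_neg)
  qed
  have disc: "discontinuous_at_origin u1" "discontinuous_at_origin u2"
    using jump unfolding u1_def u2_def
    by (auto intro!: discontinuous_shifted_solitons[OF p \<omega>] simp: soliton_minus)
  \<comment> \<open>The three solutions are told apart by their one-sided limits at the origin.\<close>
  have limits_differ: "shifted_solitons p \<omega> a b \<noteq> shifted_solitons p \<omega> a' b'"
    if "soliton p \<omega> a \<noteq> soliton p \<omega> a' \<or> soliton p \<omega> b \<noteq> soliton p \<omega> b'" for a b a' b'
    using that shifted_solitons_limits[OF p \<omega>, of a b] shifted_solitons_limits[OF p \<omega>, of a' b']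
      tendsto_unique[OF trivial_limit_at_right_real] tendsto_unique[OF trivial_limit_at_left_real]
    by metis
  have "u0 \<noteq> u1" "u0 \<noteq> u2" "u1 \<noteq> u2"
    unfolding u0 u1_def u2_def
    by (rule limits_differ; use jump in \<open>auto simp: soliton_minus\<close>)+
  then have card: "card (positive_solutions \<beta> p \<omega>) = 3"
    unfolding solutions by simp
  have "tp * (1 - tp\<^sup>2) powr (1 / (p - 2)) = tm * (1 - tm\<^sup>2) powr (1 / (p - 2))"
    "inverse tp - inverse tm = - \<beta> * sqrt \<omega>" "0 < tm" "tp < 1"
    using pair by (simp_all add: jump_pair_def slope_profile_def)
  moreover note card solutions[unfolded u0_def] disc u1_def \<open>xm < xp\<close> \<open>xm > 0\<close> u2 separated
    tp[unfolded k_def soliton_rate_def] tm[unfolded k_def soliton_rate_def]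
  ultimately show ?thesis
    by (intro conjI exI[of _ u1] exI[of _ u2] exI[of _ xp] exI[of _ xm] exI[of _ tp] exI[of _ tm])
qed

end
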